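(* Let $q$ be a prime power, $k=\mathbb{F}_q$, $n\ge 1$ an integer, $\lambda$ a nontrivial additive character of $k$, and $\chi$ a multiplicative character of $k^*$. Let $U\in \mathrm{M}_n(k)$ be a nonzero matrix and let $u$ be the rank of $U$. Then $$G_{\mathrm{GL}_n(k)}(U,\chi,\lambda)=\begin{cases}\bar{\chi}(\det U)\,q^{\binom{n}{2}}\,G(\chi,\lambda)^n & \text{if } u=n,\\[4pt] (-1)^u q^{\binom{n}{2}}\displaystyle\prod_{i=1}^{n-u}(q^i-1) & \text{if } \chi=1,\\[4pt] 0 & \text{if } u<n \text{ and } \chi\neq 1.\end{cases}$$
   Context: $\mathrm{M}_n(k)$ is the set of $n\times n$ matrices over $k$. For $U=(u_{ij}),V=(v_{ij})\in \mathrm{M}_n(k)$, put $U\cdot V=\sum_{1\le i,j\le n}u_{ij}v_{ij}\in k$ (entrywise product summed, not matrix multiplication). Additive characters are homomorphisms $(k,+)\to\mathbb{C}^*$, multiplicative characters are homomorphisms $k^*\to\mathbb{C}^*$; $\chi=1$ denotes the trivial multiplicative character and $\bar\chi$ the complex conjugate of $\chi$. Define $$G_{\mathrm{GL}_n(k)}(U,\chi,\lambda)=\sum_{X\in \mathrm{GL}_n(k)}\chi(\det X)\,\lambda(U\cdot X),$$ and let $$G(\chi,\lambda)=\sum_{x\in k^*}\chi(x)\lambda(x)$$ be the classical Gauss sum. Empty products equal $1$. *)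

theory Defs
  imports Complex_Main "Jordan_Normal_Form.Determinant" "Jordan_Normal_Form.DL_Rank"
begin

definition additive_character :: "('a::field \<Rightarrow> complex) \<Rightarrow> bool" where
  "additive_character lam \<longleftrightarrow>
     (\<forall>x. lam x \<noteq> 0) \<and> (\<forall>x y. lam (x + y) = lam x * lam y)"

definition trivial_additive_character :: "('a::field \<Rightarrow> complex) \<Rightarrow> bool" where
  "trivial_additive_character lam \<longleftrightarrow> (\<forall>x. lam x = 1)"

text \<open>A character of the multiplicative group of nonzero elements is represented by a total function
  on the field. Its value at 0 is left unconstrained; none of the notions below depend on it.\<close>

definition multiplicative_character :: "('a::field \<Rightarrow> complex) \<Rightarrow> bool" where
  "multiplicative_character chi \<longleftrightarrow>
     (\<forall>x. x \<noteq> 0 \<longrightarrow> chi x \<noteq> 0) \<and>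
     (\<forall>x y. x \<noteq> 0 \<longrightarrow> y \<noteq> 0 \<longrightarrow> chi (x * y) = chi x * chi y)"

definition trivial_multiplicative_character :: "('a::field \<Rightarrow> complex) \<Rightarrow> bool" where
  "trivial_multiplicative_character chi \<longleftrightarrow> (\<forall>x. x \<noteq> 0 \<longrightarrow> chi x = 1)"

definition mat_dot :: "'a::field mat \<Rightarrow> 'a mat \<Rightarrow> 'a" where
  "mat_dot U V = (\<Sum>i<dim_row U. \<Sum>j<dim_col U. U $$ (i, j) * V $$ (i, j))"

definition GL_mat :: "nat \<Rightarrow> 'a::field mat set" where
  "GL_mat n = {X \<in> carrier_mat n n. invertible_mat X}"

definition gauss_sum_GL ::
    "nat \<Rightarrow> 'a::{finite,field} mat \<Rightarrow> ('a \<Rightarrow> complex) \<Rightarrow> ('a \<Rightarrow> complex) \<Rightarrow> complex" where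
  "gauss_sum_GL n U chi lam = (\<Sum>X\<in>GL_mat n. chi (det X) * lam (mat_dot U X))"

definition gauss_sum :: "('a::{finite,field} \<Rightarrow> complex) \<Rightarrow> ('a \<Rightarrow> complex) \<Rightarrow> complex" where
  "gauss_sum chi lam = (\<Sum>x\<in>UNIV - {0}. chi x * lam x)"

text \<open>The index set of \<open>gauss_sum_GL\<close> is finite, so the sum is not vacuously 0.\<close>

lemma finite_GL_mat: "finite (GL_mat n :: 'a::{finite,field} mat set)"
proof -
  have "carrier_mat n n \<subseteq>
      (\<lambda>f. mat n n f) ` {f :: nat \<times> nat \<Rightarrow> 'a. \<forall>ij. ij \<notin> {..<n} \<times> {..<n} \<longrightarrow> f ij = 0}"
  proof
    fix X :: "'a mat" assume X: "X \<in> carrier_mat n n"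
    let ?f = "\<lambda>ij. if ij \<in> {..<n} \<times> {..<n} then X $$ ij else 0"
    have "X = mat n n ?f" using X by (intro eq_matI) auto
    then show "X \<in> (\<lambda>f. mat n n f) `
        {f :: nat \<times> nat \<Rightarrow> 'a. \<forall>ij. ij \<notin> {..<n} \<times> {..<n} \<longrightarrow> f ij = 0}"
      by (intro image_eqI[where x = ?f]) auto
  qed
  moreover have "finite {f :: nat \<times> nat \<Rightarrow> 'a. \<forall>ij. ij \<notin> {..<n} \<times> {..<n} \<longrightarrow> f ij = 0}"
    using finite_set_of_finite_funs[of "{..<n} \<times> {..<n}" "UNIV :: 'a set" 0] by simp
  ultimately have "finite (carrier_mat n n :: 'a mat set)"
    by (meson finite_imageI finite_subset)
  then show ?thesis
    unfolding GL_mat_def by simp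
qed

end

theory Submission
  imports Defs "HOL-Library.Cardinality"
begin

text \<open>A nonzero matrix \<open>U\<close> factors as \<open>P * (V \<oplus> 1) * Q\<close> with \<open>P\<close>, \<open>Q\<close> invertible, and substituting in the
  sum turns \<open>P\<close> and \<open>Q\<close> into values of the character. Averaging the sum for \<open>V \<oplus> 1\<close> over shears that
  preserve the determinant leaves only block triangular \<open>X\<close>, so that sum is \<open>q ^ n\<close> times the classical
  Gauss sum times the sum for \<open>V\<close>. Descending in this way reaches either the empty matrix (full rank)
  or a zero matrix. For the zero matrix the sum vanishes if the multiplicative character is nontrivial;
  otherwise it is the order of the general linear group, which the same reduction computes
  through orthogonality in the last column. Ranks are followed by counting the column space, which has
  \<open>q ^ rank\<close> elements.\<close>

section \<open>Matrices over a finite field\<close>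

lemma bij_betw_mat_PiE:
  "bij_betw (\<lambda>f. mat m n f) (({..<m} \<times> {..<n}) \<rightarrow>\<^sub>E UNIV) (carrier_mat m n)"
\<comment> \<open>Restricting the entry function to the index set makes it extensional, so each
  matrix comes from exactly one function.\<close>
proof (rule bij_betwI[where g = "\<lambda>A. restrict (\<lambda>ij. A $$ ij) ({..<m} \<times> {..<n})"])
  fix f :: "nat \<times> nat \<Rightarrow> 'a" assume "f \<in> ({..<m} \<times> {..<n}) \<rightarrow>\<^sub>E UNIV"
  then have f: "f \<in> extensional ({..<m} \<times> {..<n})" by (simp add: PiE_iff)
  have "mat m n f $$ ij = f ij" if "ij \<in> {..<m} \<times> {..<n}" for ij
    using that by auto
  then show "restrict (\<lambda>ij. mat m n f $$ ij) ({..<m} \<times> {..<n}) = f"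
    by (intro extensionalityI[OF restrict_extensional f]) (simp only: restrict_apply if_True)
next
  fix A :: "'a mat" assume "A \<in> carrier_mat m n"
  then show "mat m n (restrict (\<lambda>ij. A $$ ij) ({..<m} \<times> {..<n})) = A"
    by (intro eq_matI) simp_all
qed simp_all
lemma card_carrier_mat:
  "card (carrier_mat m n :: 'a::finite mat set) = CARD('a) ^ (m * n)"
  using bij_betw_same_card[OF bij_betw_mat_PiE[where 'a = 'a, of m n]]
  by (simp add: card_PiE)

lemma finite_carrier_mat [simp]: "finite (carrier_mat m n :: 'a::finite mat set)"
  using card_carrier_mat[where 'a = 'a, of m n] by (intro card_ge_0_finite) simp

lemma card_carrier_vec:
  "card (carrier_vec n :: 'a::finite vec set) = CARD('a) ^ n"
proof -
  have "bij_betw vec_of_list {xs :: 'a list. set xs \<subseteq> UNIV \<and> length xs = n} (carrier_vec n)"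
    (is "bij_betw _ ?L _")
  proof (rule bij_betwI[where g = list_of_vec])
    show "vec_of_list \<in> ?L \<rightarrow> carrier_vec n"
      by (auto intro: carrier_vecI)
    show "list_of_vec \<in> carrier_vec n \<rightarrow> ?L"
      by auto
  qed (simp_all add: vec_list list_vec)
  from bij_betw_same_card[OF this] show ?thesis
    by (simp only: card_lists_length_eq[OF finite])
qed

lemma finite_carrier_vec [simp]: "finite (carrier_vec n :: 'a::finite vec set)"
  using card_carrier_vec[where 'a = 'a, of n] by (intro card_ge_0_finite) simp

section \<open>Invertibility through the determinant, and multiplication as a bijection\<close>

lemma obtain_inverse_mat:
  fixes A :: "'a::field mat"
  assumes "A \<in> carrier_mat n n" "det A \<noteq> 0"
  obtains B where "B \<in> carrier_mat n n" "A * B = 1\<^sub>m n" "B * A = 1\<^sub>m n"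
  using det_non_zero_imp_unit[OF assms] unfolding Units_def ring_mat_def by auto

lemma inverse_imp_det_nonzero:
  fixes A :: "'a::field mat"
  assumes "A \<in> carrier_mat n n" "B \<in> carrier_mat n n" "A * B = 1\<^sub>m n"
  shows "det A \<noteq> 0"
  using det_mult[OF assms(1,2)] assms(3) by auto

lemma invertible_mat_iff_det:
  fixes A :: "'a::field mat"
  assumes A: "A \<in> carrier_mat n n"
  shows "invertible_mat A \<longleftrightarrow> det A \<noteq> 0"
proof
  assume "invertible_mat A"
  then obtain B where B: "A * B = 1\<^sub>m (dim_row A)" "B * A = 1\<^sub>m (dim_row B)"
    unfolding invertible_mat_def inverts_mat_def by auto
  \<comment> \<open>The shape of \<open>B\<close> is not part of \<open>invertible_mat\<close>;
    comparing column counts in the two product equations gives it.\<close>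
  have "dim_row B = n" "dim_col B = n"
    using A arg_cong[OF B(1), of dim_col] arg_cong[OF B(2), of dim_col] by auto
  then show "det A \<noteq> 0"
    using A B by (intro inverse_imp_det_nonzero[OF A, of B]) auto
next
  assume "det A \<noteq> 0"
  from obtain_inverse_mat[OF A this] show "invertible_mat A"
    using A unfolding invertible_mat_def inverts_mat_def by (metis carrier_matD square_mat.simps)
qed

lemma bij_betw_mult_left:
  fixes P :: "'a::field mat"
  assumes P: "P \<in> carrier_mat m m" "det P \<noteq> 0"
  shows "bij_betw (\<lambda>X. P * X) (carrier_mat m n) (carrier_mat m n)"
proof -
  obtain R where R: "R \<in> carrier_mat m m" "P * R = 1\<^sub>m m" "R * P = 1\<^sub>m m"
    using obtain_inverse_mat[OF P] .
  have "R * (P * X) = X" "P * (R * X) = X" if "X \<in> carrier_mat m n" for X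
    using that P R assoc_mult_mat[of R m m P m X n] assoc_mult_mat[of P m m R m X n] by auto
  then show ?thesis
    using P R by (intro bij_betwI[where g = "\<lambda>X. R * X"]) auto
qed

lemma bij_betw_mult_right:
  fixes Q :: "'a::field mat"
  assumes Q: "Q \<in> carrier_mat n n" "det Q \<noteq> 0"
  shows "bij_betw (\<lambda>X. X * Q) (carrier_mat m n) (carrier_mat m n)"
proof -
  obtain R where R: "R \<in> carrier_mat n n" "Q * R = 1\<^sub>m n" "R * Q = 1\<^sub>m n"
    using obtain_inverse_mat[OF Q] .
  have "X * Q * R = X" "X * R * Q = X" if "X \<in> carrier_mat m n" for X
    using that Q R assoc_mult_mat[of X m n Q n R n] assoc_mult_mat[of X m n R n Q n] by auto
  then show ?thesis
    using Q R by (intro bij_betwI[where g = "\<lambda>X. X * R"]) auto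
qed

section \<open>Block decomposition and the bilinear pairing\<close>

lemma sum_carrier_mat_four_block:
  fixes g :: "'a::zero mat \<Rightarrow> 'b::comm_monoid_add"
  shows "(\<Sum>X\<in>carrier_mat (m1 + m2) (n1 + n2). g X) =
    (\<Sum>A\<in>carrier_mat m1 n1. \<Sum>B\<in>carrier_mat m1 n2. \<Sum>C\<in>carrier_mat m2 n1. \<Sum>D\<in>carrier_mat m2 n2.
      g (four_block_mat A B C D))"
proof -
  let ?S = "carrier_mat m1 n1 \<times> carrier_mat m1 n2 \<times> carrier_mat m2 n1 \<times> carrier_mat m2 n2"
  let ?f = "\<lambda>(A, B, C, D). four_block_mat A B C D"
  let ?h = "\<lambda>X. split_block X m1 n1"
  have "bij_betw ?f ?S (carrier_mat (m1 + m2) (n1 + n2) :: 'a mat set)"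
  proof (rule bij_betwI[where g = ?h])
    show "?f \<in> ?S \<rightarrow> carrier_mat (m1 + m2) (n1 + n2)" by auto
    show "?h \<in> carrier_mat (m1 + m2) (n1 + n2) \<rightarrow> ?S"
      by (auto simp: split_block_def Let_def)
    show "?h (?f x) = x" if "x \<in> ?S" for x
      using that by (auto simp: split_block_def Let_def intro!: eq_matI)
    show "?f (?h X) = X" if "X \<in> carrier_mat (m1 + m2) (n1 + n2)" for X
      using that split_block(5)[OF _ carrier_matD(1)[OF that] carrier_matD(2)[OF that]]
      by (cases "?h X") auto
  qed
  from sum.reindex_bij_betw[OF this, of g]
  have "(\<Sum>X\<in>carrier_mat (m1 + m2) (n1 + n2). g X) = (\<Sum>x\<in>?S. g (?f x))" by simp
  also have "\<dots> = (\<Sum>(A, B, C, D)\<in>?S. g (four_block_mat A B C D))"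
    by (intro sum.cong) auto
  finally show ?thesis
    by (simp add: sum.cartesian_product)
qed

lemma mat_dot_four_block:
  assumes "A \<in> carrier_mat m1 n1" "B \<in> carrier_mat m1 n2" "C \<in> carrier_mat m2 n1" "D \<in> carrier_mat m2 n2"
    and "A' \<in> carrier_mat m1 n1" "B' \<in> carrier_mat m1 n2" "C' \<in> carrier_mat m2 n1" "D' \<in> carrier_mat m2 n2"
  shows "mat_dot (four_block_mat A B C D) (four_block_mat A' B' C' D') =
    mat_dot A A' + mat_dot B B' + (mat_dot C C' + mat_dot D D')"
proof -
  have split: "(\<Sum>i<a + b. f i) = (\<Sum>i<a. f i) + (\<Sum>i<b. f (a + i))" for a b and f :: "nat \<Rightarrow> 'a"
    by (induction b) (auto simp: add.assoc)
  have dims: "dim_row A = m1" "dim_col A = n1" "dim_row B = m1" "dim_col B = n2"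
    "dim_row C = m2" "dim_col C = n1" "dim_row D = m2" "dim_col D = n2"
    "dim_row A' = m1" "dim_col A' = n1" "dim_row B' = m1" "dim_col B' = n2"
    "dim_row C' = m2" "dim_col C' = n1" "dim_row D' = m2" "dim_col D' = n2"
    using assms by auto
  show ?thesis
    by (simp add: mat_dot_def dims split sum.distrib)
qed

lemma mat_dot_transpose:
  assumes "A \<in> carrier_mat m n" "B \<in> carrier_mat m n"
  shows "mat_dot A\<^sup>T B\<^sup>T = mat_dot A B"
  using assms unfolding mat_dot_def by (subst sum.swap) auto

text \<open>The pairing is the trace form tr(U^T V), so left multiplication by \<open>P\<close> has
  adjoint \<open>P\<^sup>T\<close>. This moves invertible factors of \<open>U\<close> onto the
  summation variable.\<close>

lemma mat_dot_mult_left: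
  assumes P: "P \<in> carrier_mat m k" and A: "A \<in> carrier_mat k n" and X: "X \<in> carrier_mat m n"
  shows "mat_dot (P * A) X = mat_dot A (P\<^sup>T * X)"
proof -
  have "mat_dot (P * A) X = (\<Sum>i<m. \<Sum>j<n. \<Sum>l<k. P $$ (i, l) * A $$ (l, j) * X $$ (i, j))"
    using P A X unfolding mat_dot_def
    by (auto simp: scalar_prod_def sum_distrib_right lessThan_atLeast0 intro!: sum.cong)
  also have "\<dots> = (\<Sum>i<m. \<Sum>l<k. \<Sum>j<n. P $$ (i, l) * A $$ (l, j) * X $$ (i, j))"
    by (intro sum.cong refl sum.swap)
  also have "\<dots> = (\<Sum>l<k. \<Sum>i<m. \<Sum>j<n. P $$ (i, l) * A $$ (l, j) * X $$ (i, j))"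
    by (rule sum.swap)
  also have "\<dots> = (\<Sum>l<k. \<Sum>j<n. \<Sum>i<m. P $$ (i, l) * A $$ (l, j) * X $$ (i, j))"
    by (intro sum.cong refl sum.swap)
  also have "\<dots> = mat_dot A (P\<^sup>T * X)"
    using P A X unfolding mat_dot_def
    by (auto simp: scalar_prod_def sum_distrib_left lessThan_atLeast0 mult_ac intro!: sum.cong)
  finally show ?thesis .
qed

text \<open>Transposing both arguments exchanges left and right multiplication, which reduces this
  to \<open>mat_dot_mult_left\<close>.\<close>

lemma mat_dot_mult_right:
  assumes A: "A \<in> carrier_mat m k" and Q: "Q \<in> carrier_mat k n" and X: "X \<in> carrier_mat m n"
  shows "mat_dot (A * Q) X = mat_dot A (X * Q\<^sup>T)"
proof -
  have "mat_dot (A * Q) X = mat_dot (Q\<^sup>T * A\<^sup>T) X\<^sup>T"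
    using mat_dot_transpose[of "A * Q" m n X] assms by (simp add: transpose_mult[OF A Q])
  also have "\<dots> = mat_dot A\<^sup>T (Q * X\<^sup>T)"
    using assms mat_dot_mult_left[of "Q\<^sup>T" n k "A\<^sup>T" m "X\<^sup>T"] by simp
  also have "\<dots> = mat_dot A (X * Q\<^sup>T)"
    using mat_dot_transpose[of A m k "X * Q\<^sup>T"] assms transpose_mult[of X m n "Q\<^sup>T" k] by simp
  finally show ?thesis .
qed

text \<open>Clearing the row and column of a nonzero entry, which two swaps move to the corner.\<close>

lemma nonzero_mat_decomposition:
  fixes U :: "'a::field mat"
  assumes U: "U \<in> carrier_mat (Suc n) (Suc n)" "U \<noteq> 0\<^sub>m (Suc n) (Suc n)"
  obtains P Q V where "P \<in> carrier_mat (Suc n) (Suc n)" "det P \<noteq> 0"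
    "Q \<in> carrier_mat (Suc n) (Suc n)" "det Q \<noteq> 0" "V \<in> carrier_mat n n"
    "U = P * four_block_mat V (0\<^sub>m n 1) (0\<^sub>m 1 n) (1\<^sub>m 1) * Q"
proof -
  obtain i j where ij: "i < Suc n" "j < Suc n" "U $$ (i, j) \<noteq> 0"
    using U by (metis eq_matI carrier_matD index_zero_mat)
  \<comment> \<open>The swaps bring the entry \<open>(i, j)\<close> to the corner
    \<open>(n, n)\<close>; each is its own inverse, so \<open>U\<close> is recovered from
    \<open>W\<close> as \<open>S * W * T\<close>.\<close>
  define S T where "S = (swaprows_mat (Suc n) i n :: 'a mat)" and "T = (swaprows_mat (Suc n) j n :: 'a mat)"
  have ST: "S \<in> carrier_mat (Suc n) (Suc n)" "T \<in> carrier_mat (Suc n) (Suc n)"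
    "S * S = 1\<^sub>m (Suc n)" "T * T = 1\<^sub>m (Suc n)"
    using ij by (auto simp: S_def T_def swaprows_mat_inv)
  define W where "W = S * U * T"
  have W: "W \<in> carrier_mat (1 * n + 1) (1 * n + 1)" using ST U by (simp add: W_def)
  have SU: "swaprows i n U = S * U" unfolding S_def using U ij by (intro swaprows_mat) auto
  have "W $$ (n, n) = U $$ (i, j)"
  proof -
    have "W = mat_swapcols j n (S * U)"
      unfolding W_def T_def using U ST ij by (intro swapcols_mat[symmetric]) auto
    then show ?thesis unfolding SU[symmetric] using U ij by auto
  qed
  then have d0: "W $$ (n, n) \<noteq> 0" using ij by simp
  obtain A b c D where split: "split_block W n n = (A, b, c, D)" by (metis prod_cases4)
  note blocks = split_block[OF split, of 1 1]
  have A: "A \<in> carrier_mat n n" and b: "b \<in> carrier_mat n 1" and c: "c \<in> carrier_mat 1 n"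
    and D: "D \<in> carrier_mat 1 1" and Weq: "W = four_block_mat A b c D"
    using blocks W by auto
  define d where "d = W $$ (n, n)"
  have Dd: "D = d \<cdot>\<^sub>m 1\<^sub>m 1"
    using D A by (intro eq_matI) (auto simp: d_def Weq)
  \<comment> \<open>With \<open>e\<close> equal to \<open>b\<close> divided by \<open>d\<close>,
    \<open>V\<close> becomes the Schur complement of the corner entry, and \<open>L\<close>,
    \<open>R\<close> are the triangular factors of the block elimination.\<close>
  define e where "e = inverse d \<cdot>\<^sub>m b"
  have e: "e \<in> carrier_mat n 1" using b by (simp add: e_def)
  define V where "V = A - e * c"
  have V: "V \<in> carrier_mat n n" unfolding V_def using e c by (intro minus_carrier_mat mult_carrier_mat)
  define L where "L = four_block_mat (1\<^sub>m n) e (0\<^sub>m 1 n) (1\<^sub>m 1)"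
  define R where "R = four_block_mat (1\<^sub>m n) (0\<^sub>m n 1) c D"
  let ?V = "four_block_mat V (0\<^sub>m n 1) (0\<^sub>m 1 n) (1\<^sub>m 1)"
  have "L * ?V = four_block_mat V e (0\<^sub>m 1 n) (1\<^sub>m 1)"
    unfolding L_def using V e by (subst mult_four_block_mat[of _ n n _ 1 _ 1 _ _ n _ 1]) auto
  also have "\<dots> * R = four_block_mat (V + e * c) (e * D) c D"
    unfolding R_def using V e c D
    by (subst mult_four_block_mat[of _ n n _ 1 _ 1 _ _ n _ 1]) auto
  also have "V + e * c = A" unfolding V_def using A e c by (intro eq_matI) auto
  also have "e * D = b"
    unfolding Dd e_def using b d0 by (intro eq_matI) (auto simp: d_def)
  finally have LVR: "L * ?V * R = W" by (simp add: Weq)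
  have L: "L \<in> carrier_mat (Suc n) (Suc n)" "det L \<noteq> 0"
    using det_four_block_mat_lower_left_zero[of "1\<^sub>m n" n e 1 "0\<^sub>m 1 n" "1\<^sub>m 1"] e
    by (auto simp: L_def four_block_carrier_mat[of _ n n _ 1 1, simplified])
  have "det D = d" using D by (simp add: Dd det_single)
  then have R: "R \<in> carrier_mat (Suc n) (Suc n)" "det R \<noteq> 0"
    using det_four_block_mat_upper_right_zero[of "1\<^sub>m n" n "0\<^sub>m n 1" 1 c D] c D d0
    by (auto simp: R_def d_def four_block_carrier_mat[of _ n n _ 1 1, simplified])
  have V': "?V \<in> carrier_mat (Suc n) (Suc n)"
    using V by (auto simp: four_block_carrier_mat[of _ n n _ 1 1, simplified])
  have dST: "det S \<noteq> 0" "det T \<noteq> 0"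
    using inverse_imp_det_nonzero ST by blast+
  have "(S * L) * ?V * (R * T) = S * (L * ?V * R) * T"
    using ST L R V' by (simp add: assoc_mult_mat[of _ "Suc n" "Suc n" _ "Suc n" _ "Suc n"])
  also have "\<dots> = (S * S) * U * (T * T)"
    unfolding LVR W_def using ST(1,2) U
    by (simp add: assoc_mult_mat[of _ "Suc n" "Suc n" _ "Suc n" _ "Suc n"])
  also have "\<dots> = U" using ST(3,4) U by simp
  finally show thesis
    using ST L R V dST by (intro that[of "S * L" "R * T" V]) (auto simp: det_mult[of _ "Suc n"])
qed


section \<open>Rank read off from the number of elements of the column space\<close>

lemma card_col_space:
  fixes A :: "'a::{finite,field} mat"
  assumes A: "A \<in> carrier_mat n m"
  shows "card ((\<lambda>v. A *\<^sub>v v) ` carrier_vec m) = CARD('a) ^ vec_space.rank n A"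
proof -
  interpret vec_space "TYPE('a)" n .
  have image: "(\<lambda>v. B *\<^sub>v v) ` carrier_vec k = span (set (cols B))" if "B \<in> carrier_mat n k" for B k
    using col_space_eq[OF that] carrier_matD[OF that] that unfolding col_space_def by auto
  \<comment> \<open>A maximal independent set \<open>B\<close> of columns spans the column space, so
    counting coordinate vectors with respect to \<open>B\<close> counts that space.\<close>
  let ?S = "set (cols A)"
  have S: "?S \<subseteq> carrier_vec n" using cols_dim A by blast
  have "\<exists>B. finite B \<and> maximal B (\<lambda>T. T \<subseteq> ?S \<and> lin_indpt T) \<and> {} \<subseteq> B"
    by (rule maximal_exists_superset[of ?S]) (simp_all, metis dim_zero_vs finite_lin_indpt2 lin_dep_def empty_subsetI subset_empty emptyE finite.emptyI)
  then obtain B where B: "maximal B (\<lambda>T. T \<subseteq> ?S \<and> lin_indpt T)" by blast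
  then have BS: "B \<subseteq> ?S" and indpt: "lin_indpt B" by (auto simp: maximal_def)
  have Bc: "B \<subseteq> carrier_vec n" using BS S by blast
  have "finite B" using BS finite_subset by blast
  then obtain bs where bs: "set bs = B" "distinct bs" using finite_distinct_list by blast
  have "?S \<subseteq> span B"
  proof
    fix s assume s: "s \<in> ?S"
    show "s \<in> span B"
    proof (rule ccontr)
      assume ns: "s \<notin> span B"
      then have "s \<notin> B" using in_own_span Bc by blast
      have "lin_indpt (B \<union> {s})"
        using lin_dep_iff_in_span[of B s] Bc S s indpt ns \<open>s \<notin> B\<close> by auto
      then show False
        using B s BS \<open>s \<notin> B\<close> unfolding maximal_def by blast
    qed
  qed
  then have span: "span B = span ?S"
    using span_is_subset[of ?S "span B"] span_is_monotone[OF BS] span_is_submodule[of B] Bc by simp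
  define M where "M = mat_of_cols n bs"
  have cols: "cols M = bs" using Bc bs by (simp add: M_def cols_mat_of_cols)
  have M: "M \<in> carrier_mat n (length bs)" by (simp add: M_def)
  \<comment> \<open>Independence makes coordinates unique: a nonzero kernel vector of
    \<open>M\<close> would be a linear relation among \<open>bs\<close>.\<close>
  have "inj_on (\<lambda>v. M *\<^sub>v v) (carrier_vec (length bs))"
  proof (rule inj_onI)
    fix v w assume v: "v \<in> carrier_vec (length bs)" and w: "w \<in> carrier_vec (length bs)"
      and eq: "M *\<^sub>v v = M *\<^sub>v w"
    have "M *\<^sub>v (v - w) = 0\<^sub>v n"
      using M v w eq by (simp add: mult_minus_distrib_mat_vec)
    then have "v - w = 0\<^sub>v (length bs)"
      using lin_depI[OF M minus_carrier_vec[OF v w]] cols bs indpt by auto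
    then show "v = w"
      using v w by (auto simp: vec_eq_iff)
  qed
  then have "card ((\<lambda>v. M *\<^sub>v v) ` carrier_vec (length bs)) = CARD('a) ^ card B"
    using distinct_card[OF bs(2)] bs(1) by (simp add: card_image card_carrier_vec)
  then show ?thesis
    using image[OF A] image[OF M] cols bs span rank_card_indpt[OF A B] by simp
qed

text \<open>A field has at least two elements, so powers of its size determine their exponents and
  ranks can be found by counting images.\<close>

lemma rank_eqI:
  fixes A :: "'a::{finite,field} mat"
  assumes "A \<in> carrier_mat n m"
    and "card ((\<lambda>v. A *\<^sub>v v) ` carrier_vec m) = CARD('a) ^ r"
  shows "vec_space.rank n A = r"
proof -
  have "card {0, 1 :: 'a} \<le> CARD('a)" by (intro card_mono) auto
  then show ?thesis
    using card_col_space[OF assms(1)] assms(2) by simp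
qed


text \<open>The column space is a single point, so every vector has the same image as the zero
  vector; unit vectors then read off the entries.\<close>

lemma rank_eq_0_imp_zero:
  fixes A :: "'a::{finite,field} mat"
  assumes A: "A \<in> carrier_mat n m" and r: "vec_space.rank n A = 0"
  shows "A = 0\<^sub>m n m"
proof -
  have "card ((\<lambda>v. A *\<^sub>v v) ` carrier_vec m) = 1"
    using card_col_space[OF A] r by simp
  then obtain w where "(\<lambda>v. A *\<^sub>v v) ` carrier_vec m = {w}" by (rule card_1_singletonE)
  then have "A *\<^sub>v v = w" if "v \<in> carrier_vec m" for v using that by blast
  then have eq: "A *\<^sub>v unit_vec m j = A *\<^sub>v 0\<^sub>v m" for j by simp
  have "A $$ (i, j) = 0" if ij: "i < n" "j < m" for i j
  proof -
    have "A $$ (i, j) = (A *\<^sub>v unit_vec m j) $ i"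
      using A ij by (simp add: scalar_prod_right_unit[of j m])
    also have "\<dots> = 0" unfolding eq using A ij by simp
    finally show ?thesis .
  qed
  then show ?thesis
    using A by (intro eq_matI) auto
qed

text \<open>The invertible \<open>P\<close> maps the column space of \<open>A\<close> injectively
  onto that of \<open>P * A\<close>.\<close>

lemma rank_mult_left:
  fixes A P :: "'a::{finite,field} mat"
  assumes P: "P \<in> carrier_mat n n" "det P \<noteq> 0" and A: "A \<in> carrier_mat n m"
  shows "vec_space.rank n (P * A) = vec_space.rank n A"
proof (rule rank_eqI)
  show PA: "P * A \<in> carrier_mat n m" using P A by simp
  obtain R where R: "R \<in> carrier_mat n n" "R * P = 1\<^sub>m n" using obtain_inverse_mat[OF P] by metis
  let ?I = "(\<lambda>v. A *\<^sub>v v) ` carrier_vec m"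
  have "R *\<^sub>v (P *\<^sub>v w) = w" if "w \<in> ?I" for w
  proof -
    have w: "w \<in> carrier_vec n" using that A by auto
    show ?thesis using assoc_mult_mat_vec[OF R(1) P(1) w] w R(2) by simp
  qed
  then have "inj_on (\<lambda>w. P *\<^sub>v w) ?I" by (metis inj_on_inverseI)
  then have "card ((\<lambda>w. P *\<^sub>v w) ` ?I) = card ?I" by (rule card_image)
  also have "(\<lambda>w. P *\<^sub>v w) ` ?I = (\<lambda>v. (P * A) *\<^sub>v v) ` carrier_vec m"
    unfolding image_image using assoc_mult_mat_vec[OF P(1) A] by (intro image_cong) auto
  finally show "card ((\<lambda>v. (P * A) *\<^sub>v v) ` carrier_vec m) = CARD('a) ^ vec_space.rank n A"
    using card_col_space[OF A] by simp
qed

text \<open>\<open>Q\<close> maps the domain onto itself, so \<open>A * Q\<close> and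
  \<open>A\<close> have the same image.\<close>

lemma rank_mult_right:
  fixes A Q :: "'a::{finite,field} mat"
  assumes Q: "Q \<in> carrier_mat m m" "det Q \<noteq> 0" and A: "A \<in> carrier_mat n m"
  shows "vec_space.rank n (A * Q) = vec_space.rank n A"
proof (rule rank_eqI)
  show AQ: "A * Q \<in> carrier_mat n m" using Q A by simp
  obtain R where R: "R \<in> carrier_mat m m" "Q * R = 1\<^sub>m m" using obtain_inverse_mat[OF Q] by metis
  have "Q *\<^sub>v (R *\<^sub>v v) = v" if "v \<in> carrier_vec m" for v
    using assoc_mult_mat_vec[OF Q(1) R(1) that] that R(2) by simp
  then have "v \<in> (\<lambda>v. Q *\<^sub>v v) ` carrier_vec m" if "v \<in> carrier_vec m" for v
    using that R(1) by (metis image_eqI mult_mat_vec_carrier)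
  moreover have "Q *\<^sub>v v \<in> carrier_vec m" if "v \<in> carrier_vec m" for v
    using that Q(1) by simp
  ultimately have "(\<lambda>v. Q *\<^sub>v v) ` carrier_vec m = carrier_vec m" by blast
  then have "(\<lambda>v. A *\<^sub>v v) ` carrier_vec m = (\<lambda>v. A *\<^sub>v v) ` (\<lambda>v. Q *\<^sub>v v) ` carrier_vec m" by simp
  also have "\<dots> = (\<lambda>v. (A * Q) *\<^sub>v v) ` carrier_vec m"
    unfolding image_image using assoc_mult_mat_vec[OF A Q(1)] by (intro image_cong) auto
  finally show "card ((\<lambda>v. (A * Q) *\<^sub>v v) ` carrier_vec m) = CARD('a) ^ vec_space.rank n A"
    using card_col_space[OF A] by simp
qed

text \<open>The image is the product of the image of \<open>V\<close> with a line, so its size gains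
  one factor of the field size.\<close>

lemma rank_block_one:
  fixes V :: "'a::{finite,field} mat"
  assumes V: "V \<in> carrier_mat n n"
  shows "vec_space.rank (Suc n) (four_block_mat V (0\<^sub>m n 1) (0\<^sub>m 1 n) (1\<^sub>m 1)) = Suc (vec_space.rank n V)"
proof (rule rank_eqI)
  let ?W = "four_block_mat V (0\<^sub>m n 1) (0\<^sub>m 1 n) (1\<^sub>m 1)"
  show "?W \<in> carrier_mat (Suc n) (Suc n)"
    using V by (auto simp: four_block_carrier_mat[of _ n n _ 1 1, simplified])
  let ?I = "(\<lambda>v. V *\<^sub>v v) ` carrier_vec n"
  have split: "carrier_vec (Suc n) = (\<lambda>(a, d). a @\<^sub>v d) ` (carrier_vec n \<times> carrier_vec 1)"
  proof (intro equalityI subsetI)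
    fix v :: "'b vec" assume v: "v \<in> carrier_vec (Suc n)"
    have "v = vec_first v n @\<^sub>v vec_last v 1"
      using v by (intro vec_first_last_append[symmetric]) simp
    then show "v \<in> (\<lambda>(a, d). a @\<^sub>v d) ` (carrier_vec n \<times> carrier_vec 1)"
      by (intro image_eqI[of _ _ "(vec_first v n, vec_last v 1)"]) auto
  next
    fix v :: "'b vec" assume "v \<in> (\<lambda>(a, d). a @\<^sub>v d) ` (carrier_vec n \<times> carrier_vec 1)"
    then show "v \<in> carrier_vec (Suc n)"
      using append_carrier_vec[of _ n _ 1] by auto
  qed
  have mult: "?W *\<^sub>v (a @\<^sub>v d) = (V *\<^sub>v a) @\<^sub>v d"
    if "a \<in> carrier_vec n" "d \<in> carrier_vec 1" for a d
  proof -
    have "0\<^sub>m n 1 *\<^sub>v d = 0\<^sub>v n" "0\<^sub>m 1 n *\<^sub>v a = 0\<^sub>v 1" using that by auto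
    then show ?thesis
      using that V by (subst four_block_mat_mult_vec[OF V zero_carrier_mat zero_carrier_mat one_carrier_mat]) auto
  qed
  have "(\<lambda>v. ?W *\<^sub>v v) ` carrier_vec (Suc n) = (\<lambda>(a, d). (V *\<^sub>v a) @\<^sub>v d) ` (carrier_vec n \<times> carrier_vec 1)"
    unfolding split image_image by (intro image_cong) (auto simp: mult[unfolded One_nat_def])
  also have "\<dots> = (\<lambda>(a, d). a @\<^sub>v d) ` (?I \<times> carrier_vec 1)"
    by force
  finally have "card ((\<lambda>v. ?W *\<^sub>v v) ` carrier_vec (Suc n)) = card ((\<lambda>(a, d). a @\<^sub>v d) ` (?I \<times> carrier_vec 1))"
    by simp
  also have "\<dots> = card (?I \<times> (carrier_vec 1 :: 'a vec set))"
  proof (rule card_image, rule inj_onI, clarify)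
    fix a d a' d' assume "a \<in> carrier_vec n" "a' \<in> carrier_vec n"
      and "V *\<^sub>v a @\<^sub>v d = V *\<^sub>v a' @\<^sub>v d'"
    then show "V *\<^sub>v a = V *\<^sub>v a' \<and> d = d'"
      using V by (subst (asm) append_vec_eq[of _ n]) auto
  qed
  also have "\<dots> = CARD('a) ^ Suc (vec_space.rank n V)"
    using card_col_space[OF V] by (simp add: card_cartesian_product card_carrier_vec)
  finally show "card ((\<lambda>v. ?W *\<^sub>v v) ` carrier_vec (Suc n)) = CARD('a) ^ Suc (vec_space.rank n V)" .
qed

section \<open>The Gauss sum over all matrices\<close>

lemma choose_2_Suc: "Suc n choose 2 = n + (n choose 2)"
  by (simp add: numeral_2_eq_2)

text \<open>A multiplicative character extended by 0 turns the sum over the general linear group into a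
  sum over all matrices, whose blocks can be summed independently.\<close>

locale gauss_characters =
  fixes chi lam :: "'a::{finite,field} \<Rightarrow> complex"
  assumes lam_add: "lam (x + y) = lam x * lam y"
    and lam_nonzero: "lam x \<noteq> 0"
    and lam_nontrivial: "\<exists>x. lam x \<noteq> 1"
    and chi_mult: "chi (x * y) = chi x * chi y"
    and chi_0 [simp]: "chi 0 = 0"
    and chi_1 [simp]: "chi 1 = 1"
begin

definition mat_sum :: "nat \<Rightarrow> 'a mat \<Rightarrow> complex" where
  "mat_sum n U = (\<Sum>X\<in>carrier_mat n n. chi (det X) * lam (mat_dot U X))"

lemma lam_0 [simp]: "lam 0 = 1"
  using lam_add[of 0 0] lam_nonzero[of 0] by simp

lemma chi_nonzero: "x \<noteq> 0 \<Longrightarrow> chi x \<noteq> 0"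
  using chi_mult[of x "inverse x"] by auto

text \<open>Orthogonality of additive characters: for nonzero \<open>B\<close>, a translation of
  \<open>T\<close> multiplies the sum by a value of \<open>lam\<close> other than 1, which forces it
  to vanish.\<close>

lemma sum_lam_mat_dot:
  assumes B: "B \<in> carrier_mat m n"
  shows "(\<Sum>T\<in>carrier_mat m n. lam (mat_dot T B)) = (if B = 0\<^sub>m m n then of_nat (CARD('a) ^ (m * n)) else 0)"
proof (cases "B = 0\<^sub>m m n")
  case True
  have "mat_dot T B = 0" if "T \<in> carrier_mat m n" for T
    using that by (simp add: mat_dot_def True)
  then show ?thesis using True by (simp add: card_carrier_mat)
next
  case False
  then obtain i j where ij: "i < m" "j < n" "B $$ (i, j) \<noteq> 0"
    using B by (metis eq_matI carrier_matD index_zero_mat)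
  obtain x where x: "lam x \<noteq> 1" using lam_nontrivial by blast
  \<comment> \<open>The only nonzero entry sits where \<open>B\<close> does not vanish and is scaled
    to make the pairing with \<open>B\<close> equal to \<open>x\<close>.\<close>
  define E where "E = mat m n (\<lambda>ij. if ij = (i, j) then x / B $$ (i, j) else 0)"
  have E: "E \<in> carrier_mat m n" by (simp add: E_def)
  have "mat_dot E B = (\<Sum>a<m. \<Sum>b<n. if a = i then (if b = j then x else 0) else 0)"
    unfolding mat_dot_def E_def using ij by (auto intro!: sum.cong)
  also have "\<dots> = (\<Sum>a<m. if a = i then (\<Sum>b<n. if b = j then x else 0) else 0)"
    by (intro sum.cong) auto
  also have "\<dots> = x" using ij by simp
  finally have EB: "mat_dot E B = x" .
  have "bij_betw (\<lambda>T. T + E) (carrier_mat m n) (carrier_mat m n :: 'a mat set)"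
    using E by (intro bij_betwI[where g = "\<lambda>T. T - E"]) (auto intro!: eq_matI)
  from sum.reindex_bij_betw[OF this, of "\<lambda>T. lam (mat_dot T B)"]
  have "(\<Sum>T\<in>carrier_mat m n. lam (mat_dot T B)) = (\<Sum>T\<in>carrier_mat m n. lam (mat_dot (T + E) B))"
    by simp
  also have "\<dots> = (\<Sum>T\<in>carrier_mat m n. lam x * lam (mat_dot T B))"
  proof (intro sum.cong refl)
    fix T :: "'a mat" assume T: "T \<in> carrier_mat m n"
    have "mat_dot (T + E) B = mat_dot T B + mat_dot E B"
      using T E by (auto simp: mat_dot_def distrib_right sum.distrib)
    then show "lam (mat_dot (T + E) B) = lam x * lam (mat_dot T B)"
      by (simp add: EB lam_add)
  qed
  finally have "(\<Sum>T\<in>carrier_mat m n. lam (mat_dot T B)) = lam x * (\<Sum>T\<in>carrier_mat m n. lam (mat_dot T B))"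
    by (simp only: sum_distrib_left[symmetric])
  then show ?thesis using x False by simp
qed

lemma sum_carrier_mat_1_1:
  "(\<Sum>D\<in>carrier_mat 1 1. g (D $$ (0, 0))) = (\<Sum>x\<in>UNIV. g (x :: 'a))"
proof -
  have "bij_betw (\<lambda>x :: 'a. mat 1 1 (\<lambda>_. x)) UNIV (carrier_mat 1 1)"
    by (rule bij_betwI[where g = "\<lambda>D. D $$ (0, 0)"]) (auto intro!: eq_matI)
  from sum.reindex_bij_betw[OF this, of "\<lambda>D. g (D $$ (0, 0))"] show ?thesis by simp
qed

section \<open>Change of variables and removal of a corner 1\<close>

lemma mat_sum_mult_left:
  assumes P: "P \<in> carrier_mat n n" "det P \<noteq> 0" and U: "U \<in> carrier_mat n n"
  shows "chi (det P) * mat_sum n (P * U) = mat_sum n U"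
proof -
  have PT: "P\<^sup>T \<in> carrier_mat n n" "det P\<^sup>T \<noteq> 0" using P by (auto simp: det_transpose)
  \<comment> \<open>Substituting \<open>P\<^sup>T * X\<close> for \<open>X\<close> lets adjointness
    shift \<open>P\<close> onto \<open>U\<close>, while multiplicativity of the determinant splits
    off \<open>chi (det P)\<close>.\<close>
  have "mat_sum n U = (\<Sum>X\<in>carrier_mat n n. chi (det (P\<^sup>T * X)) * lam (mat_dot U (P\<^sup>T * X)))"
    unfolding mat_sum_def by (rule sum.reindex_bij_betw[OF bij_betw_mult_left[OF PT], symmetric])
  also have "\<dots> = (\<Sum>X\<in>carrier_mat n n. chi (det P) * (chi (det X) * lam (mat_dot (P * U) X)))"
    using det_mult[OF PT(1)] mat_dot_mult_left[OF P(1) U]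
    by (intro sum.cong) (auto simp: det_transpose[OF P(1)] chi_mult)
  finally show ?thesis by (simp add: mat_sum_def sum_distrib_left)
qed

lemma mat_sum_mult_right:
  assumes Q: "Q \<in> carrier_mat n n" "det Q \<noteq> 0" and U: "U \<in> carrier_mat n n"
  shows "chi (det Q) * mat_sum n (U * Q) = mat_sum n U"
proof -
  have QT: "Q\<^sup>T \<in> carrier_mat n n" "det Q\<^sup>T \<noteq> 0" using Q by (auto simp: det_transpose)
  have "mat_sum n U = (\<Sum>X\<in>carrier_mat n n. chi (det (X * Q\<^sup>T)) * lam (mat_dot U (X * Q\<^sup>T)))"
    unfolding mat_sum_def by (rule sum.reindex_bij_betw[OF bij_betw_mult_right[OF QT], symmetric])
  also have "\<dots> = (\<Sum>X\<in>carrier_mat n n. chi (det Q) * (chi (det X) * lam (mat_dot (U * Q) X)))"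
    using det_mult[OF _ QT(1)] mat_dot_mult_right[OF U Q(1)]
    by (intro sum.cong) (auto simp: det_transpose[OF Q(1)] chi_mult)
  finally show ?thesis by (simp add: mat_sum_def sum_distrib_left)
qed

lemma mat_sum_mult:
  assumes P: "P \<in> carrier_mat n n" "det P \<noteq> 0" and Q: "Q \<in> carrier_mat n n" "det Q \<noteq> 0"
    and U: "U \<in> carrier_mat n n"
  shows "chi (det P) * chi (det Q) * mat_sum n (P * U * Q) = mat_sum n U"
  using mat_sum_mult_left[OF P U] mat_sum_mult_right[OF Q, of "P * U"] P U by (simp add: mult.assoc)

text \<open>The sum does not change when the zero column above the corner 1 is replaced by any column \<open>T\<close>.
  Averaging over \<open>T\<close> kills every \<open>X\<close> whose last column is nonzero above the corner.\<close>

lemma mat_sum_block_one: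
  assumes V: "V \<in> carrier_mat n n"
  shows "mat_sum (Suc n) (four_block_mat V (0\<^sub>m n 1) (0\<^sub>m 1 n) (1\<^sub>m 1)) =
    of_nat CARD('a) ^ n * gauss_sum chi lam * mat_sum n V"
proof -
  define q where "q = (of_nat CARD('a) :: complex)"
  have q0: "q \<noteq> 0" by (simp add: q_def)
  define W where "W T = four_block_mat V T (0\<^sub>m 1 n) (1\<^sub>m 1)" for T
  have W: "W T \<in> carrier_mat (Suc n) (Suc n)" for T
    using V by (auto simp: W_def four_block_carrier_mat[of _ n n _ 1 1, simplified])
  \<comment> \<open>\<open>W T\<close> arises from \<open>W (0\<^sub>m n 1)\<close> by a shear of
    determinant 1, so the change of variables introduces no value of \<open>chi\<close>.\<close>
  have same: "mat_sum (Suc n) (W T) = mat_sum (Suc n) (W (0\<^sub>m n 1))" if T: "T \<in> carrier_mat n 1" for T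
  proof -
    let ?L = "four_block_mat (1\<^sub>m n) T (0\<^sub>m 1 n) (1\<^sub>m 1)"
    have L: "?L \<in> carrier_mat (Suc n) (Suc n)"
      by (auto simp: four_block_carrier_mat[of _ n n _ 1 1, simplified])
    have det: "det ?L = 1"
      using det_four_block_mat_lower_left_zero[of "1\<^sub>m n" n T 1 "0\<^sub>m 1 n" "1\<^sub>m 1"] T by simp
    have "?L * W (0\<^sub>m n 1) = W T"
      unfolding W_def using V T by (subst mult_four_block_mat[of _ n n _ 1 _ 1 _ _ n _ 1]) auto
    then show ?thesis using mat_sum_mult_left[OF L _ W[of "0\<^sub>m n 1"]] det by simp
  qed
  let ?N = "carrier_mat n n :: 'a mat set" and ?C = "carrier_mat n 1 :: 'a mat set"
    and ?R = "carrier_mat 1 n :: 'a mat set" and ?O = "carrier_mat 1 1 :: 'a mat set"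
  \<comment> \<open>The factor \<open>q ^ n\<close> is the number of columns \<open>T\<close>; it
    sets up the averaging and is cancelled at the end.\<close>
  have "q ^ n * mat_sum (Suc n) (W (0\<^sub>m n 1)) = (\<Sum>T\<in>?C. mat_sum (Suc n) (W (0\<^sub>m n 1)))"
    by (simp add: card_carrier_mat q_def)
  also have "\<dots> = (\<Sum>T\<in>?C. mat_sum (Suc n) (W T))"
    by (intro sum.cong refl same[symmetric])
  also have "\<dots> = (\<Sum>T\<in>?C. \<Sum>X\<in>carrier_mat (n + 1) (n + 1). chi (det X) * lam (mat_dot (W T) X))"
    by (simp add: mat_sum_def)
  also have "\<dots> = (\<Sum>X\<in>carrier_mat (n + 1) (n + 1). \<Sum>T\<in>?C. chi (det X) * lam (mat_dot (W T) X))"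
    by (rule sum.swap)
  also have "\<dots> = (\<Sum>A\<in>?N. \<Sum>B\<in>?C. \<Sum>C\<in>?R. \<Sum>D\<in>?O. \<Sum>T\<in>?C.
      chi (det (four_block_mat A B C D)) * lam (mat_dot (W T) (four_block_mat A B C D)))"
    by (rule sum_carrier_mat_four_block)
  \<comment> \<open>Only \<open>lam (mat_dot T B)\<close> depends on \<open>T\<close>, so
    orthogonality leaves \<open>B = 0\<^sub>m n 1\<close>. Then \<open>X\<close> is block lower
    triangular, its determinant factors, and \<open>C\<close> no longer enters the summand.\<close>
  also have "\<dots> = (\<Sum>A\<in>?N. \<Sum>B\<in>?C. \<Sum>C\<in>?R. \<Sum>D\<in>?O.
      if B = 0\<^sub>m n 1 then q ^ n * (chi (det A) * lam (mat_dot V A)) * (chi (D $$ (0, 0)) * lam (D $$ (0, 0))) else 0)"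
  proof (intro sum.cong refl)
    fix A B C D :: "'a mat" assume A: "A \<in> ?N" and B: "B \<in> ?C" and C: "C \<in> ?R" and D: "D \<in> ?O"
    let ?X = "four_block_mat A B C D"
    have "mat_dot (0\<^sub>m 1 n) C = 0" "mat_dot (1\<^sub>m 1) D = D $$ (0, 0)"
      by (simp_all add: mat_dot_def)
    then have "lam (mat_dot (W T) ?X) = lam (mat_dot V A) * lam (D $$ (0, 0)) * lam (mat_dot T B)"
      if T: "T \<in> ?C" for T
      unfolding W_def mat_dot_four_block[OF V T zero_carrier_mat one_carrier_mat A B C D]
      by (simp add: lam_add)
    then have "(\<Sum>T\<in>?C. chi (det ?X) * lam (mat_dot (W T) ?X)) =
        chi (det ?X) * lam (mat_dot V A) * lam (D $$ (0, 0)) * (\<Sum>T\<in>?C. lam (mat_dot T B))"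
      by (simp add: sum_distrib_left mult.assoc)
    also have "(\<Sum>T\<in>?C. lam (mat_dot T B)) = (if B = 0\<^sub>m n 1 then q ^ n else 0)"
      by (simp only: sum_lam_mat_dot[OF B] q_def of_nat_power mult_1_right)
    finally have "(\<Sum>T\<in>?C. chi (det ?X) * lam (mat_dot (W T) ?X)) =
        chi (det ?X) * lam (mat_dot V A) * lam (D $$ (0, 0)) * (if B = 0\<^sub>m n 1 then q ^ n else 0)" .
    moreover have "det ?X = det A * D $$ (0, 0)" if "B = 0\<^sub>m n 1"
      using det_four_block_mat_upper_right_zero[OF A that C D] D by (simp add: det_single)
    ultimately show "(\<Sum>T\<in>?C. chi (det ?X) * lam (mat_dot (W T) ?X)) =
        (if B = 0\<^sub>m n 1 then q ^ n * (chi (det A) * lam (mat_dot V A)) * (chi (D $$ (0, 0)) * lam (D $$ (0, 0))) else 0)"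
      by (cases "B = 0\<^sub>m n 1") (simp_all add: chi_mult)
  qed
  \<comment> \<open>The free block \<open>C\<close> contributes a second \<open>q ^ n\<close>, the
    one that survives; the corner \<open>D\<close> contributes the classical Gauss sum.\<close>
  also have "\<dots> = (\<Sum>A\<in>?N. \<Sum>B\<in>?C. if B = 0\<^sub>m n 1 then
      q ^ n * (q ^ n * (chi (det A) * lam (mat_dot V A)) * gauss_sum chi lam) else 0)"
  proof (intro sum.cong refl)
    fix A B :: "'a mat"
    let ?c = "q ^ n * (chi (det A) * lam (mat_dot V A))"
    \<comment> \<open>Because \<open>chi 0 = 0\<close>, summing over the whole field or over its
      nonzero elements gives the same value.\<close>
    have "(\<Sum>D\<in>?O. chi (D $$ (0, 0)) * lam (D $$ (0, 0))) = gauss_sum chi lam"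
      unfolding sum_carrier_mat_1_1[of "\<lambda>x. chi x * lam x"] gauss_sum_def
      by (intro sum.mono_neutral_right) auto
    then have "(\<Sum>C\<in>?R. \<Sum>D\<in>?O. ?c * (chi (D $$ (0, 0)) * lam (D $$ (0, 0)))) = q ^ n * (?c * gauss_sum chi lam)"
      by (simp only: sum_distrib_left[symmetric] sum_constant card_carrier_mat q_def of_nat_power mult_1)
        (simp only: mult_ac)
    then show "(\<Sum>C\<in>?R. \<Sum>D\<in>?O. if B = 0\<^sub>m n 1 then ?c * (chi (D $$ (0, 0)) * lam (D $$ (0, 0))) else 0) =
        (if B = 0\<^sub>m n 1 then q ^ n * (?c * gauss_sum chi lam) else 0)"
      by (cases "B = 0\<^sub>m n 1") (simp_all only: if_True if_False sum.neutral_const simp_thms)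
  qed
  also have "\<dots> = (\<Sum>A\<in>?N. q ^ n * (q ^ n * (chi (det A) * lam (mat_dot V A)) * gauss_sum chi lam))"
    by (simp only: sum.delta[OF finite_carrier_mat] zero_carrier_mat if_True)
  also have "\<dots> = q ^ n * (q ^ n * gauss_sum chi lam * mat_sum n V)"
    by (simp only: mat_sum_def sum_distrib_left mult_ac)
  finally have "q ^ n * mat_sum (Suc n) (W (0\<^sub>m n 1)) = q ^ n * (q ^ n * gauss_sum chi lam * mat_sum n V)" .
  then have "mat_sum (Suc n) (W (0\<^sub>m n 1)) = q ^ n * gauss_sum chi lam * mat_sum n V"
    using q0 by (simp only: mult_cancel_left power_eq_0_iff simp_thms)
  then show ?thesis by (simp only: W_def q_def)
qed

section \<open>Full rank\<close>

lemma mat_sum_0_dim: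
  assumes U: "U \<in> carrier_mat 0 0"
  shows "mat_sum 0 U = 1"
proof -
  have "carrier_mat 0 0 = {1\<^sub>m 0 :: 'a mat}" by auto
  then show ?thesis using U by (simp add: mat_sum_def mat_dot_def)
qed

text \<open>Peeling off one diagonal 1 at a time yields one Gauss sum each and powers of the field
  size with exponents n - 1, ..., 0, which add up to \<open>n choose 2\<close>.\<close>

lemma mat_sum_one:
  "mat_sum n (1\<^sub>m n) = of_nat CARD('a) ^ (n choose 2) * gauss_sum chi lam ^ n"
proof (induction n)
  case 0
  show ?case by (simp add: mat_sum_0_dim binomial_eq_0)
next
  case (Suc n)
  have "mat_sum (Suc n) (1\<^sub>m (Suc n)) = mat_sum (Suc n) (four_block_mat (1\<^sub>m n) (0\<^sub>m n 1) (0\<^sub>m 1 n) (1\<^sub>m 1))"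
    using four_block_one_mat[of n 1, where 'a = 'a] by simp
  also have "\<dots> = of_nat CARD('a) ^ n * gauss_sum chi lam * mat_sum n (1\<^sub>m n)"
    by (rule mat_sum_block_one) simp
  finally show ?case by (simp add: Suc choose_2_Suc power_add mult_ac)
qed

text \<open>In a finite field two powers of \<open>x\<close> coincide, hence so do two powers of the
  positive real \<open>norm (chi x)\<close>, which is possible only for 1. This turns the inverse of
  a character value into its conjugate.\<close>

lemma norm_chi:
  assumes x: "x \<noteq> 0"
  shows "norm (chi x) = 1"
proof -
  have "\<not> inj (\<lambda>k :: nat. x ^ k)"
    using finite_imageD[of "\<lambda>k. x ^ k" "UNIV :: nat set"] by auto
  then obtain i j where ij: "x ^ i = x ^ j" "i < j"
    unfolding inj_def by (metis linorder_neqE_nat)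
  have pow: "chi (x ^ k) = chi x ^ k" for k by (induction k) (auto simp: chi_mult)
  have "norm (chi x) ^ i = norm (chi x) ^ j"
    using arg_cong[OF ij(1), of "\<lambda>y. norm (chi y)"] by (simp add: pow norm_power)
  moreover have "norm (chi x) > 0" using chi_nonzero[OF x] by simp
  ultimately show ?thesis
    using ij(2) power_strict_increasing[OF ij(2), of "norm (chi x)"]
      power_strict_decreasing[OF ij(2), of "norm (chi x)"] by (metis less_irrefl linorder_neqE)
qed

text \<open>The change of variables applied to \<open>U * 1\<^sub>m n\<close> leaves the sum for the
  identity matrix; \<open>chi (det U)\<close> is inverted by conjugation.\<close>

lemma mat_sum_full_rank:
  assumes U: "U \<in> carrier_mat n n" and det: "det U \<noteq> 0"
  shows "mat_sum n U = cnj (chi (det U)) * of_nat CARD('a) ^ (n choose 2) * gauss_sum chi lam ^ n"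
proof -
  have "cnj (chi (det U)) * chi (det U) = 1"
    using norm_chi[OF det] complex_norm_square[of "chi (det U)"] by (simp add: mult.commute)
  then have "mat_sum n U = cnj (chi (det U)) * (chi (det U) * mat_sum n U)"
    by (simp only: mult.assoc[symmetric] mult_1_left)
  also have "chi (det U) * mat_sum n U = mat_sum n (1\<^sub>m n)"
    using mat_sum_mult_left[OF U det, of "1\<^sub>m n"] U by simp
  finally show ?thesis by (simp add: mat_sum_one mult.assoc)
qed

text \<open>The common inductive step: size and rank both drop by one, so the corank is preserved.
  The scalar \<open>c\<close> is the product of the two determinants, and \<open>chi c\<close> can
  be divided out.\<close>

lemma mat_sum_nonzero_reduction:
  assumes U: "U \<in> carrier_mat (Suc n) (Suc n)" "U \<noteq> 0\<^sub>m (Suc n) (Suc n)"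
  obtains c V where "V \<in> carrier_mat n n" "vec_space.rank (Suc n) U = Suc (vec_space.rank n V)"
    "c \<noteq> 0" "chi c * mat_sum (Suc n) U = of_nat CARD('a) ^ n * gauss_sum chi lam * mat_sum n V"
proof -
  obtain P Q V where P: "P \<in> carrier_mat (Suc n) (Suc n)" "det P \<noteq> 0"
    and Q: "Q \<in> carrier_mat (Suc n) (Suc n)" "det Q \<noteq> 0" and V: "V \<in> carrier_mat n n"
    and eq: "U = P * four_block_mat V (0\<^sub>m n 1) (0\<^sub>m 1 n) (1\<^sub>m 1) * Q"
    using nonzero_mat_decomposition[OF U] by metis
  let ?W = "four_block_mat V (0\<^sub>m n 1) (0\<^sub>m 1 n) (1\<^sub>m 1)"
  have W: "?W \<in> carrier_mat (Suc n) (Suc n)"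
    using V by (auto simp: four_block_carrier_mat[of _ n n _ 1 1, simplified])
  have "vec_space.rank (Suc n) U = vec_space.rank (Suc n) ?W"
    unfolding eq using P Q W
    by (simp only: rank_mult_right[OF Q mult_carrier_mat[OF P(1) W]] rank_mult_left[OF P W])
  then have rank: "vec_space.rank (Suc n) U = Suc (vec_space.rank n V)"
    by (simp only: rank_block_one[OF V])
  have "chi (det P * det Q) * mat_sum (Suc n) U = of_nat CARD('a) ^ n * gauss_sum chi lam * mat_sum n V"
    using mat_sum_mult[OF P Q W] unfolding eq[symmetric] mat_sum_block_one[OF V] by (simp only: chi_mult)
  then show thesis using P Q V rank by (intro that[of V "det P * det Q"]) simp_all
qed

section \<open>Deficient rank with a nontrivial multiplicative character\<close>

lemma mat_sum_zero_nontrivial: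
  assumes a: "a \<noteq> 0" "chi a \<noteq> 1"
  shows "mat_sum (Suc n) (0\<^sub>m (Suc n) (Suc n)) = 0"
proof -
  \<comment> \<open>Scaling a row by \<open>a\<close> fixes the zero matrix, so the sum equals
    \<open>chi a\<close> times itself.\<close>
  let ?P = "multrow_mat (Suc n) 0 a"
  have "det ?P = a" by (rule det_multrow_mat) simp
  then have "chi a * mat_sum (Suc n) (0\<^sub>m (Suc n) (Suc n)) = mat_sum (Suc n) (0\<^sub>m (Suc n) (Suc n))"
    using mat_sum_mult_left[of ?P "Suc n" "0\<^sub>m (Suc n) (Suc n)"] a by simp
  then show ?thesis using a by simp
qed

text \<open>The corank stays positive under the reduction, so the descent ends at a zero matrix of
  positive size, where the sum vanishes.\<close>

lemma mat_sum_rank_deficient: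
  assumes a: "a \<noteq> 0" "chi a \<noteq> 1"
    and "U \<in> carrier_mat n n" "vec_space.rank n U < n"
  shows "mat_sum n U = 0"
  using assms(3,4)
proof (induction n arbitrary: U)
  case 0
  then show ?case by simp
next
  case (Suc n)
  show ?case
  proof (cases "U = 0\<^sub>m (Suc n) (Suc n)")
    case True
    then show ?thesis using mat_sum_zero_nontrivial[OF a] by simp
  next
    case False
    obtain c V where "V \<in> carrier_mat n n" "vec_space.rank (Suc n) U = Suc (vec_space.rank n V)"
      "c \<noteq> 0" "chi c * mat_sum (Suc n) U = of_nat CARD('a) ^ n * gauss_sum chi lam * mat_sum n V"
      using mat_sum_nonzero_reduction[OF Suc.prems(1) False] by metis
    then show ?thesis using Suc chi_nonzero[of c] by simp
  qed
qed

section \<open>The trivial multiplicative character\<close>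

context
  assumes chi_trivial: "x \<noteq> 0 \<Longrightarrow> chi x = 1"
begin

text \<open>By orthogonality \<open>lam\<close> sums to 0 over the whole field, and the omitted term
  at 0 is 1.\<close>

lemma gauss_sum_trivial: "gauss_sum chi lam = -1"
proof -
  have "(\<Sum>x\<in>UNIV. lam x) = 0"
  proof -
    have "(\<Sum>x\<in>UNIV. lam x) = (\<Sum>D\<in>carrier_mat 1 1. lam (mat_dot D (1\<^sub>m 1)))"
      unfolding sum_carrier_mat_1_1[symmetric] by (intro sum.cong) (auto simp: mat_dot_def)
    also have "\<dots> = 0"
      unfolding sum_lam_mat_dot[OF one_carrier_mat]
      by (metis if_False index_one_mat(1) index_zero_mat(1) zero_neq_one less_one)
    finally show ?thesis .
  qed
  then have "(\<Sum>x\<in>UNIV - {0}. lam x) = -1"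
    by (simp add: sum_diff1)
  then show ?thesis by (simp add: gauss_sum_def chi_trivial)
qed

text \<open>Summing over all matrices \<open>T * E\<close> supported on the last column counts the invertible matrices with
  zero last column, of which there are none; every nonzero \<open>T\<close> gives the same term.\<close>

lemma mat_sum_zero_trivial:
  "mat_sum (Suc n) (0\<^sub>m (Suc n) (Suc n)) =
    (of_nat CARD('a) ^ Suc n - 1) * of_nat CARD('a) ^ n * mat_sum n (0\<^sub>m n n)"
proof -
  let ?m = "Suc n" and ?q = "of_nat CARD('a) :: complex"
  let ?C = "carrier_mat ?m 1 :: 'a mat set"
  \<comment> \<open>\<open>E\<close> is the last unit row vector: \<open>T * E\<close> has
    \<open>T\<close> as last column and zeros elsewhere, and \<open>X * E\<^sup>T\<close> is the
    last column of \<open>X\<close>.\<close>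
  define E :: "'a mat" where "E = mat 1 ?m (\<lambda>(i, j). if j = n then 1 else 0)"
  have E: "E \<in> carrier_mat 1 ?m" by (simp add: E_def)
  have E0: "E $$ (0, n) = 1" by (simp add: E_def)
  have ET: "E\<^sup>T \<in> carrier_mat ?m 1" using E by simp
  have "(\<Sum>T\<in>?C. mat_sum ?m (T * E)) =
      (\<Sum>T\<in>?C. \<Sum>X\<in>carrier_mat ?m ?m. chi (det X) * lam (mat_dot T (X * E\<^sup>T)))"
    unfolding mat_sum_def by (intro sum.cong refl) (simp only: mat_dot_mult_right[OF _ E])
  also have "\<dots> = (\<Sum>X\<in>carrier_mat ?m ?m. \<Sum>T\<in>?C. chi (det X) * lam (mat_dot T (X * E\<^sup>T)))"
    by (rule sum.swap)
  also have "\<dots> = 0"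
  proof (rule sum.neutral, rule ballI)
    fix X :: "'a mat" assume X: "X \<in> carrier_mat ?m ?m"
    have "X * E\<^sup>T \<noteq> 0\<^sub>m ?m 1" if detX: "det X \<noteq> 0"
    proof
      assume XE: "X * E\<^sup>T = 0\<^sub>m ?m 1"
      obtain R where R: "R \<in> carrier_mat ?m ?m" "R * X = 1\<^sub>m ?m"
        using obtain_inverse_mat[OF X detX] by metis
      have "E\<^sup>T = R * X * E\<^sup>T" using R ET by simp
      also have "\<dots> = R * (X * E\<^sup>T)" by (rule assoc_mult_mat[OF R(1) X ET])
      also have "\<dots> = 0\<^sub>m ?m 1" using R(1) by (simp add: XE)
      finally have "E\<^sup>T $$ (n, 0) = 0" by simp
      then show False using E E0 by simp
    qed
    then show "(\<Sum>T\<in>?C. chi (det X) * lam (mat_dot T (X * E\<^sup>T))) = 0"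
      unfolding sum_distrib_left[symmetric] sum_lam_mat_dot[OF mult_carrier_mat[OF X ET]]
      by (cases "det X = 0") simp_all
  qed
  finally have total: "(\<Sum>T\<in>?C. mat_sum ?m (T * E)) = 0" .
  \<comment> \<open>\<open>T * E\<close> has rank one, so its reduction \<open>V\<close> has rank 0;
    the Gauss sum -1 supplies the sign.\<close>
  have each: "mat_sum ?m (T * E) = - (?q ^ n * mat_sum n (0\<^sub>m n n))"
    if T: "T \<in> ?C - {0\<^sub>m ?m 1}" for T
  proof -
    have TE: "T * E \<in> carrier_mat ?m ?m" using T E by auto
    have col: "(T * E) $$ (i, n) = T $$ (i, 0)" if "i < ?m" for i
      using that T E E0 by (auto simp: scalar_prod_def)
    have "T * E \<noteq> 0\<^sub>m ?m ?m"
    proof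
      assume "T * E = 0\<^sub>m ?m ?m"
      then have "T $$ (i, 0) = 0" if "i < ?m" for i using col[OF that] that by simp
      then have "T = 0\<^sub>m ?m 1" using T by (intro eq_matI) auto
      then show False using T by simp
    qed
    then obtain c V where V: "V \<in> carrier_mat n n" and rank: "vec_space.rank ?m (T * E) = Suc (vec_space.rank n V)"
      and c: "c \<noteq> 0" and sum: "chi c * mat_sum ?m (T * E) = ?q ^ n * gauss_sum chi lam * mat_sum n V"
      using mat_sum_nonzero_reduction[OF TE] by metis
    \<comment> \<open>\<open>T * E\<close> factors through a one-dimensional space, so its image has
      at most as many elements as the field.\<close>
    have "CARD('a) ^ vec_space.rank ?m (T * E) = card ((\<lambda>v. (T * E) *\<^sub>v v) ` carrier_vec ?m)"
      using card_col_space[OF TE] by simp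
    also have "\<dots> \<le> card ((\<lambda>v. T *\<^sub>v v) ` carrier_vec 1)"
    proof (rule card_mono)
      show "(\<lambda>v. (T * E) *\<^sub>v v) ` carrier_vec ?m \<subseteq> (\<lambda>v. T *\<^sub>v v) ` carrier_vec 1"
      proof (rule image_subsetI)
        fix v :: "'a vec" assume v: "v \<in> carrier_vec ?m"
        have "(T * E) *\<^sub>v v = T *\<^sub>v (E *\<^sub>v v)" using T by (intro assoc_mult_mat_vec[of T ?m, OF _ E v]) simp
        then show "(T * E) *\<^sub>v v \<in> (\<lambda>v. T *\<^sub>v v) ` carrier_vec 1"
          using E v by (metis imageI mult_mat_vec_carrier)
      qed
    qed simp
    also have "\<dots> \<le> card (carrier_vec 1 :: 'a vec set)" by (rule card_image_le) simp
    also have "\<dots> = CARD('a) ^ 1" by (rule card_carrier_vec)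
    finally have le: "CARD('a) ^ vec_space.rank ?m (T * E) \<le> CARD('a) ^ 1" .
    have "1 < CARD('a)" using card_mono[of "UNIV :: 'a set" "{0, 1}"] by simp
    then have "vec_space.rank ?m (T * E) \<le> 1" using le by (rule power_le_imp_le_exp)
    then have "V = 0\<^sub>m n n" using rank rank_eq_0_imp_zero[OF V] by simp
    then show ?thesis using sum c by (simp add: chi_trivial gauss_sum_trivial)
  qed
  \<comment> \<open>Isolating the zero column expresses the sum for the zero matrix through the
    \<open>?q ^ ?m - 1\<close> equal terms of the nonzero columns.\<close>
  have "(\<Sum>T\<in>?C. mat_sum ?m (T * E)) = mat_sum ?m (0\<^sub>m ?m 1 * E) + (\<Sum>T\<in>?C - {0\<^sub>m ?m 1}. mat_sum ?m (T * E))"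
    by (rule sum.remove) simp_all
  also have "\<dots> = mat_sum ?m (0\<^sub>m ?m ?m) + (\<Sum>T\<in>?C - {0\<^sub>m ?m 1}. - (?q ^ n * mat_sum n (0\<^sub>m n n)))"
    using E by (simp only: each left_mult_zero_mat cong: sum.cong)
  also have "\<dots> = mat_sum ?m (0\<^sub>m ?m ?m) - (?q ^ ?m - 1) * (?q ^ n * mat_sum n (0\<^sub>m n n))"
    by (simp add: card_Diff_singleton card_carrier_mat of_nat_diff Suc_le_eq del: power_Suc)
  finally show ?thesis using total by (simp add: mult.assoc)
qed

text \<open>Each rank reduction contributes a sign and a power of the field size. Once the matrix is
  zero, each further dimension contributes one factor of the product, so the corank counts these
  factors.\<close>

lemma mat_sum_trivial:
  assumes "U \<in> carrier_mat n n"
  shows "mat_sum n U = (-1) ^ vec_space.rank n U * of_nat CARD('a) ^ (n choose 2) *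
    (\<Prod>i=1..n - vec_space.rank n U. (of_nat CARD('a) ^ i - 1))"
  using assms
proof (induction n arbitrary: U)
  case 0
  have "vec_space.rank 0 U = 0" using vec_space.rank_le_nc[OF 0] by simp
  then show ?case using mat_sum_0_dim[OF 0] by (simp add: binomial_eq_0)
next
  case (Suc n)
  show ?case
  proof (cases "U = 0\<^sub>m (Suc n) (Suc n)")
    case True
    \<comment> \<open>The zero matrix has rank 0 in both sizes, so the product gains exactly its
      factor for \<open>i = Suc n\<close>.\<close>
    then show ?thesis
      using Suc.IH[of "0\<^sub>m n n"]
      by (simp add: mat_sum_zero_trivial vec_space.rank_0I choose_2_Suc power_add mult_ac)
  next
    case False
    obtain c V where "V \<in> carrier_mat n n" "vec_space.rank (Suc n) U = Suc (vec_space.rank n V)"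
      "c \<noteq> 0" "chi c * mat_sum (Suc n) U = of_nat CARD('a) ^ n * gauss_sum chi lam * mat_sum n V"
      using mat_sum_nonzero_reduction[OF Suc.prems False] by metis
    then show ?thesis
      using Suc.IH[of V] by (simp add: chi_trivial gauss_sum_trivial choose_2_Suc power_add mult_ac)
  qed
qed

end

end

theorem theorem2p1:
  fixes chi lam :: "'a::{finite,field} \<Rightarrow> complex"
    and U :: "'a mat"
    and n u q :: nat
  assumes "q = card (UNIV :: 'a set)"
    and "n \<ge> 1"
    and "additive_character lam"
    and "\<not> trivial_additive_character lam"
    and "multiplicative_character chi"
    and "U \<in> carrier_mat n n"
    and "U \<noteq> 0\<^sub>m n n"
    and "u = vec_space.rank n U"
  shows "(u = n \<longrightarrow>
            gauss_sum_GL n U chi lam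
              = cnj (chi (det U)) * of_nat q ^ (n choose 2) * gauss_sum chi lam ^ n) \<and>
         (trivial_multiplicative_character chi \<longrightarrow>
            gauss_sum_GL n U chi lam
              = (-1) ^ u * of_nat q ^ (n choose 2) * (\<Prod>i=1..n - u. (of_nat q ^ i - 1))) \<and>
         (u < n \<and> \<not> trivial_multiplicative_character chi \<longrightarrow> gauss_sum_GL n U chi lam = 0)"
proof -
  \<comment> \<open>\<open>chi\<close> is unconstrained at 0; the value 0 there makes the function
    multiplicative everywhere and lets singular matrices drop out of the sum.\<close>
  define chi0 where "chi0 x = (if x = 0 then 0 else chi x)" for x
  have mult: "chi (x * y) = chi x * chi y" and nonzero: "chi x \<noteq> 0" if "x \<noteq> 0" "y \<noteq> 0" for x y
    using assms(5) that by (auto simp: multiplicative_character_def)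
  have "chi 1 = 1" using mult[of 1 1] nonzero[of 1 1] by simp
  then interpret gauss_characters chi0 lam
    using assms(3,4) mult
    by unfold_locales (auto simp: chi0_def additive_character_def trivial_additive_character_def)
  have "gauss_sum_GL n U chi lam = (\<Sum>X\<in>GL_mat n. chi0 (det X) * lam (mat_dot U X))"
    unfolding gauss_sum_GL_def GL_mat_def
    by (intro sum.cong) (auto simp: chi0_def invertible_mat_iff_det)
  also have "\<dots> = mat_sum n U"
    unfolding mat_sum_def GL_mat_def
    by (intro sum.mono_neutral_left) (auto simp: invertible_mat_iff_det)
  finally have GL: "gauss_sum_GL n U chi lam = mat_sum n U" .
  have G: "gauss_sum chi0 lam = gauss_sum chi lam"
    unfolding gauss_sum_def by (intro sum.cong) (auto simp: chi0_def)
  have "mat_sum n U = cnj (chi (det U)) * of_nat q ^ (n choose 2) * gauss_sum chi lam ^ n" if "u = n"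
  proof -
    have "det U \<noteq> 0" using that vec_space.det_rank_iff[OF assms(6)] assms(8) by simp
    then show ?thesis
      using mat_sum_full_rank[OF assms(6)] assms(1) by (simp add: G chi0_def)
  qed
  moreover have "mat_sum n U = (-1) ^ u * of_nat q ^ (n choose 2) * (\<Prod>i=1..n - u. (of_nat q ^ i - 1))"
    if "trivial_multiplicative_character chi"
  proof -
    have "chi0 x = 1" if "x \<noteq> 0" for x
      using that \<open>trivial_multiplicative_character chi\<close>
      by (simp add: chi0_def trivial_multiplicative_character_def)
    from mat_sum_trivial[OF this assms(6)] show ?thesis using assms(1,8) by simp
  qed
  moreover have "mat_sum n U = 0" if less: "u < n" and nontrivial: "\<not> trivial_multiplicative_character chi"
  proof -
    obtain a where "a \<noteq> 0" "chi0 a \<noteq> 1"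
      using nontrivial by (auto simp: trivial_multiplicative_character_def chi0_def)
    then show ?thesis using mat_sum_rank_deficient[OF _ _ assms(6)] less assms(8) by simp
  qed
  ultimately show ?thesis unfolding GL by blast
qed

end
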